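(* Assume that $X$ is a proper finite-dimensional geodesic metric space that admits a consistent, conical geodesic bicombing $\sigma$ and a cocompact group action via isometries, such that $|\partial_\sigma X|\ge2$. Then $X$ is almost $\sigma$-geodesically complete.
   Context: Dimension is covering dimension. Proper means closed balls are compact. A group action of $G$ on $X$ is cocompact if $G\backslash X$ is compact. The bicombing is not assumed to be equivariant under the group action. A (geodesic) bicombing on a geodesic metric space $(X,d)$ is a continuous map $\sigma\colon X\times X\times[0,1]\to X$ such that each $\sigma_{xy}:=\sigma(x,y,\cdot)$ is a constant speed geodesic from $x$ to $y$. It is consistent if $\operatorname{im}\sigma_{\sigma_{xy}(s),\sigma_{xy}(t)}=\operatorname{im}\sigma_{xy}|_{[s,t]}$ for all $x,y$ and $0\le s<t\le1$; conical if $d(\sigma_{xy}(t),\sigma_{x'y'}(t))\le(1-t)d(x,x')+t\,d(y,y')$ always. A $\sigma$-ray is an isometric embedding $\xi\colon[0,\infty)\to X$ with $\operatorname{im}\sigma_{\xi(0)\xi(t)}=\operatorname{im}\xi|_{[0,t]}$ for all $t\ge0$. Two $\sigma$-rays $\xi,\zeta$ are asymptotic if $\sup_{t}d(\xi(t),\zeta(t))<\infty$. $\partial_\sigma X$ is the set of asymptoty classes of $\sigma$-rays. $X$ is almost $\sigma$-geodesically complete if for some (equivalently, every) basepoint $o\in X$ there is a constant $C>0$ such that for each $x\in X$ there is a $\sigma$-ray $\xi$ with $\xi(0)=o$ and $\operatorname{im}\xi\cap\overline B(x,C)\ne\emptyset$. *)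

theory Defs
  imports "HOL-Analysis.Analysis" "HOL-Algebra.Group_Action"
begin

section \<open>Covering dimension\<close>

definition covering_dim_le :: "'a topology \<Rightarrow> nat \<Rightarrow> bool" where
  "covering_dim_le T n \<longleftrightarrow>
    (\<forall>\<U>. (\<forall>U\<in>\<U>. openin T U) \<and> \<Union>\<U> = topspace T \<longrightarrow>
      (\<exists>\<V>. (\<forall>V\<in>\<V>. openin T V) \<and> \<Union>\<V> = topspace T \<and> (\<forall>V\<in>\<V>. \<exists>U\<in>\<U>. V \<subseteq> U) \<and>
           (\<forall>x\<in>topspace T. finite {V\<in>\<V>. x \<in> V} \<and> card {V\<in>\<V>. x \<in> V} \<le> n + 1)))"

definition finite_covering_dim :: "'a topology \<Rightarrow> bool" where
  "finite_covering_dim T \<longleftrightarrow> (\<exists>n. covering_dim_le T n)"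

section \<open>Cocompact isometric actions\<close>

definition orbit_topology ::
    "('g, 'm) monoid_scheme \<Rightarrow> 'a topology \<Rightarrow> ('g \<Rightarrow> 'a \<Rightarrow> 'a) \<Rightarrow> 'a set topology" where
  "orbit_topology G T \<phi> =
    topology (\<lambda>\<W>. \<W> \<subseteq> orbits G (topspace T) \<phi> \<and>
                   openin T {x \<in> topspace T. orbit G \<phi> x \<in> \<W>})"

text \<open>The predicate above satisfies the axioms of a topology, so it does describe the open
  sets, and the result is the quotient topology.\<close>

lemma openin_orbit_topology:
  "openin (orbit_topology G T \<phi>) \<W> \<longleftrightarrow>
     \<W> \<subseteq> orbits G (topspace T) \<phi> \<and> openin T {x \<in> topspace T. orbit G \<phi> x \<in> \<W>}"
proof -
  have "istopology (\<lambda>\<W>. \<W> \<subseteq> orbits G (topspace T) \<phi> \<and>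
                   openin T {x \<in> topspace T. orbit G \<phi> x \<in> \<W>})"
    unfolding istopology_def
  proof (intro conjI allI impI; (elim conjE)?)
    fix S S'
    assume "openin T {x \<in> topspace T. orbit G \<phi> x \<in> S}"
      and "openin T {x \<in> topspace T. orbit G \<phi> x \<in> S'}"
    moreover have "{x \<in> topspace T. orbit G \<phi> x \<in> S \<inter> S'} =
        {x \<in> topspace T. orbit G \<phi> x \<in> S} \<inter> {x \<in> topspace T. orbit G \<phi> x \<in> S'}"
      by auto
    ultimately show "openin T {x \<in> topspace T. orbit G \<phi> x \<in> S \<inter> S'}"
      by auto
  next
    fix \<K>
    assume "\<forall>K\<in>\<K>. K \<subseteq> orbits G (topspace T) \<phi> \<and>
                   openin T {x \<in> topspace T. orbit G \<phi> x \<in> K}"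
    moreover have "{x \<in> topspace T. orbit G \<phi> x \<in> \<Union>\<K>} =
        (\<Union>K\<in>\<K>. {x \<in> topspace T. orbit G \<phi> x \<in> K})"
      by auto
    ultimately show "openin T {x \<in> topspace T. orbit G \<phi> x \<in> \<Union>\<K>}"
      by auto
  qed auto
  then show ?thesis
    unfolding orbit_topology_def by (simp add: topology_inverse')
qed

lemma topspace_orbit_topology:
  "topspace (orbit_topology G T \<phi>) = orbits G (topspace T) \<phi>"
proof
  show "topspace (orbit_topology G T \<phi>) \<subseteq> orbits G (topspace T) \<phi>"
    using openin_orbit_topology[of G T \<phi>] openin_topspace by blast
  have "{x \<in> topspace T. orbit G \<phi> x \<in> orbits G (topspace T) \<phi>} = topspace T"
    by (auto simp: orbits_def)
  then have "openin (orbit_topology G T \<phi>) (orbits G (topspace T) \<phi>)"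
    by (simp add: openin_orbit_topology)
  then show "orbits G (topspace T) \<phi> \<subseteq> topspace (orbit_topology G T \<phi>)"
    by (rule openin_subset)
qed

lemma quotient_map_orbit: "quotient_map T (orbit_topology G T \<phi>) (orbit G \<phi>)"
  by (auto simp: quotient_map_def topspace_orbit_topology openin_orbit_topology orbits_def)

definition isometric_action ::
    "('g, 'm) monoid_scheme \<Rightarrow> ('g \<Rightarrow> 'a::metric_space \<Rightarrow> 'a) \<Rightarrow> bool" where
  "isometric_action G \<phi> \<longleftrightarrow>
    group_action G UNIV \<phi> \<and> (\<forall>g\<in>carrier G. \<forall>x y. dist (\<phi> g x) (\<phi> g y) = dist x y)"

definition cocompact_action ::
    "('g, 'm) monoid_scheme \<Rightarrow> ('g \<Rightarrow> 'a::topological_space \<Rightarrow> 'a) \<Rightarrow> bool" where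
  "cocompact_action G \<phi> \<longleftrightarrow> compact_space (orbit_topology G euclidean \<phi>)"

section \<open>Geodesics and bicombings\<close>

definition const_speed_geodesic :: "(real \<Rightarrow> 'a::metric_space) \<Rightarrow> 'a \<Rightarrow> 'a \<Rightarrow> bool" where
  "const_speed_geodesic c x y \<longleftrightarrow>
    c 0 = x \<and> c 1 = y \<and> (\<forall>s\<in>{0..1}. \<forall>t\<in>{0..1}. dist (c s) (c t) = \<bar>s - t\<bar> * dist x y)"

definition geodesic_space :: "'a::metric_space itself \<Rightarrow> bool" where
  "geodesic_space _ \<longleftrightarrow> (\<forall>x y :: 'a. \<exists>c. const_speed_geodesic c x y)"

definition proper_metric_space :: "'a::metric_space itself \<Rightarrow> bool" where
  "proper_metric_space _ \<longleftrightarrow> (\<forall>(x :: 'a) r. compact (cball x r))"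

definition geodesic_bicombing :: "('a::metric_space \<Rightarrow> 'a \<Rightarrow> real \<Rightarrow> 'a) \<Rightarrow> bool" where
  "geodesic_bicombing \<sigma> \<longleftrightarrow>
    continuous_on (UNIV \<times> UNIV \<times> {0..1}) (\<lambda>(x, y, t). \<sigma> x y t) \<and>
    (\<forall>x y. const_speed_geodesic (\<sigma> x y) x y)"

definition consistent_bicombing :: "('a::metric_space \<Rightarrow> 'a \<Rightarrow> real \<Rightarrow> 'a) \<Rightarrow> bool" where
  "consistent_bicombing \<sigma> \<longleftrightarrow>
    (\<forall>x y s t. 0 \<le> s \<and> s < t \<and> t \<le> 1 \<longrightarrow> \<sigma> (\<sigma> x y s) (\<sigma> x y t) ` {0..1} = \<sigma> x y ` {s..t})"

definition conical_bicombing :: "('a::metric_space \<Rightarrow> 'a \<Rightarrow> real \<Rightarrow> 'a) \<Rightarrow> bool" where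
  "conical_bicombing \<sigma> \<longleftrightarrow>
    (\<forall>x y x' y'. \<forall>t\<in>{0..1}. dist (\<sigma> x y t) (\<sigma> x' y' t) \<le> (1 - t) * dist x x' + t * dist y y')"

section \<open>Rays and the boundary at infinity\<close>

text \<open>Rays are represented by functions on all of \<open>\<real>\<close> whose values at negative parameters are
  ignored. Rays agreeing on \<open>[0,\<infinity>)\<close> are asymptotic, so this does not affect the set of classes.\<close>

definition sigma_ray :: "('a::metric_space \<Rightarrow> 'a \<Rightarrow> real \<Rightarrow> 'a) \<Rightarrow> (real \<Rightarrow> 'a) \<Rightarrow> bool" where
  "sigma_ray \<sigma> \<xi> \<longleftrightarrow>
    (\<forall>s\<ge>0. \<forall>t\<ge>0. dist (\<xi> s) (\<xi> t) = \<bar>s - t\<bar>) \<and>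
    (\<forall>t\<ge>0. \<sigma> (\<xi> 0) (\<xi> t) ` {0..1} = \<xi> ` {0..t})"

definition asymptotic :: "(real \<Rightarrow> 'a::metric_space) \<Rightarrow> (real \<Rightarrow> 'a) \<Rightarrow> bool" where
  "asymptotic \<xi> \<zeta> \<longleftrightarrow> bdd_above ((\<lambda>t. dist (\<xi> t) (\<zeta> t)) ` {0..})"

definition sigma_boundary ::
    "('a::metric_space \<Rightarrow> 'a \<Rightarrow> real \<Rightarrow> 'a) \<Rightarrow> (real \<Rightarrow> 'a) set set" where
  "sigma_boundary \<sigma> =
    Collect (sigma_ray \<sigma>) // {(\<xi>, \<zeta>). sigma_ray \<sigma> \<xi> \<and> sigma_ray \<sigma> \<zeta> \<and> asymptotic \<xi> \<zeta>}"

lemma equiv_asymptotic: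
  "equiv (Collect (sigma_ray \<sigma>)) {(\<xi>, \<zeta>). sigma_ray \<sigma> \<xi> \<and> sigma_ray \<sigma> \<zeta> \<and> asymptotic \<xi> \<zeta>}"
proof (rule equivI)
  show "trans {(\<xi>, \<zeta>). sigma_ray \<sigma> \<xi> \<and> sigma_ray \<sigma> \<zeta> \<and> asymptotic \<xi> \<zeta>}"
  proof (rule transI, clarsimp)
    fix \<xi> \<zeta> \<eta> :: "real \<Rightarrow> 'a"
    assume "asymptotic \<xi> \<zeta>" "asymptotic \<zeta> \<eta>"
    then obtain A B where "\<forall>t\<ge>0. dist (\<xi> t) (\<zeta> t) \<le> A" "\<forall>t\<ge>0. dist (\<zeta> t) (\<eta> t) \<le> B"
      by (auto simp: asymptotic_def bdd_above_def)
    then have "\<forall>t\<ge>0. dist (\<xi> t) (\<eta> t) \<le> A + B"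
      by (meson add_mono dist_triangle order_trans)
    then show "asymptotic \<xi> \<eta>"
      by (auto simp: asymptotic_def bdd_above_def)
  qed
qed (auto simp: refl_on_def sym_def asymptotic_def dist_commute)

definition almost_geodesically_complete ::
    "('a::metric_space \<Rightarrow> 'a \<Rightarrow> real \<Rightarrow> 'a) \<Rightarrow> bool" where
  "almost_geodesically_complete \<sigma> \<longleftrightarrow>
    (\<exists>p. \<exists>C>0. \<forall>x. \<exists>\<xi>. sigma_ray \<sigma> \<xi> \<and> \<xi> 0 = p \<and> \<xi> ` {0..} \<inter> cball x C \<noteq> {})"

end

theory Submission
  imports Defs "HOL-Library.Z2" "HOL-Library.Diagonal_Subsequence"
begin

text \<open>
  Suppose that no \<open>\<sigma>\<close>-ray from \<open>p\<close> meets a large ball around some point \<open>x\<close>. By compactness the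
  segments \<open>\<sigma> p y\<close> with \<open>dist p y \<ge> R\<close> miss this ball for some \<open>R\<close>, so moving every point the distance
  \<open>R\<close> towards \<open>p\<close> (and the \<open>R\<close>-ball around \<open>p\<close> to \<open>p\<close>) is a homotopy of bounded displacement from the
  identity to a map whose image misses the ball. Conjugating by the cocompact action produces such
  homotopies, with uniform displacement, for balls around every point. Hence compactly supported
  Alexander--Spanier cocycles modulo 2 are coboundaries, with uniform control of the supports.

  On a space of covering dimension at most \<open>n\<close> this is impossible. A cover of order \<open>n + 1\<close> by bounded
  sets yields cochains \<open>c s\<close>, indexed by finite sets \<open>s\<close> of members of the cover and supported near
  every member of \<open>s\<close>, such that the coboundary of \<open>c s\<close> is the sum of the \<open>c (insert v s)\<close> over
  \<open>v \<notin> s\<close>, and \<open>c s = 0\<close> if \<open>card s \<ge> n + 2\<close>. If \<open>m > 0\<close> is the largest cardinality with a nonzero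
  \<open>c s\<close>, then the \<open>c s\<close> with \<open>card s = m\<close> are cocycles, and a cochain homotopy built from their
  primitives replaces them by \<open>0\<close> while preserving the relations. Descending to \<open>m = 0\<close> shows that the
  coboundary of \<open>c {}\<close> vanishes on points; but its value there is \<open>c {} [] = 1\<close>.
\<close>

section \<open>Cochains modulo 2\<close>

text \<open>Cochains are functions on lists of points, in all degrees at once: a list of length
  \<open>k + 1\<close> is an ordered \<open>k\<close>-simplex. The value sums \<open>u\<close> over
  all deletions of one entry. The complex is augmented, since
  \<open>cobd u [x] = u []\<close>.\<close>

fun cobd :: "('a list \<Rightarrow> bit) \<Rightarrow> 'a list \<Rightarrow> bit" where
  "cobd u [] = 0"
| "cobd u (x # xs) = u xs + cobd (\<lambda>ys. u (x # ys)) xs"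

text \<open>The usual prism operator: it sums \<open>u\<close> over the lists that apply
  \<open>g\<close> up to some entry, repeat that entry under \<open>h\<close>, and go on with
  \<open>h\<close>.\<close>

fun prism :: "('a \<Rightarrow> 'a) \<Rightarrow> ('a \<Rightarrow> 'a) \<Rightarrow> ('a list \<Rightarrow> bit) \<Rightarrow> 'a list \<Rightarrow> bit" where
  "prism g h u [] = 0"
| "prism g h u (x # xs) = u (g x # h x # map h xs) + prism g h (\<lambda>ys. u (g x # ys)) xs"

text \<open>These rules rewrite sums of bits into conditionals and so hide the additive structure.\<close>

declare add_bit_eq_xor [simp del] mult_bit_eq_and [simp del] bit_not_zero_iff [simp del]

lemma bit_double [simp]: "a + a = (0::bit)"
  by (cases a) simp_all

lemma bit_double_left [simp]: "a + (a + b) = (b::bit)"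
  by (simp flip: add.assoc)

lemma cobd_add: "cobd (\<lambda>ys. u ys + v ys) xs = cobd u xs + cobd v xs"
  by (induction xs arbitrary: u v) (simp_all add: ac_simps)

lemma cobd_zero [simp]: "cobd (\<lambda>ys. 0) xs = 0"
  by (induction xs) simp_all

lemma cobd_sum: "cobd (\<lambda>ys. \<Sum>i\<in>I. u i ys) xs = (\<Sum>i\<in>I. cobd (u i) xs)"
  by (induction I rule: infinite_finite_induct) (simp_all add: cobd_add)

lemma prism_add: "prism g h (\<lambda>ys. u ys + v ys) xs = prism g h u xs + prism g h v xs"
  by (induction xs arbitrary: u v) (simp_all add: ac_simps)

lemma cobd_cobd: "cobd (cobd u) xs = 0"
  by (induction xs arbitrary: u) (simp_all add: cobd_add)

lemma cobd_map: "cobd u (map f xs) = cobd (\<lambda>ys. u (map f ys)) xs"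
  by (induction xs arbitrary: u) simp_all

lemma cobd_nonzeroD:
  assumes "cobd u xs \<noteq> 0"
  shows "\<exists>ys. set ys \<subseteq> set xs \<and> u ys \<noteq> 0"
  using assms
proof (induction xs arbitrary: u)
  case (Cons x xs)
  show ?case
  proof (cases "u xs = 0")
    case True
    then have "cobd (\<lambda>ys. u (x # ys)) xs \<noteq> 0"
      using Cons.prems by simp
    from Cons.IH[OF this] obtain ys where "set ys \<subseteq> set xs" "u (x # ys) \<noteq> 0"
      by blast
    then show ?thesis
      by (intro exI[of _ "x # ys"]) auto
  qed (intro exI[of _ xs], auto)
qed simp

lemma prism_nonzeroD:
  assumes "prism g h u xs \<noteq> 0"
  shows "\<exists>ys. set ys \<subseteq> g ` set xs \<union> h ` set xs \<and> u ys \<noteq> 0"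
  using assms
proof (induction xs arbitrary: u)
  case (Cons x xs)
  show ?case
  proof (cases "u (g x # h x # map h xs) = 0")
    case True
    then have "prism g h (\<lambda>ys. u (g x # ys)) xs \<noteq> 0"
      using Cons.prems by simp
    from Cons.IH[OF this] obtain ys where "set ys \<subseteq> g ` set xs \<union> h ` set xs" "u (g x # ys) \<noteq> 0"
      by blast
    then show ?thesis
      by (intro exI[of _ "g x # ys"]) auto
  qed (intro exI[of _ "g x # h x # map h xs"], auto)
qed simp

text \<open>The cochain homotopy formula, free of signs modulo 2: the inner faces of adjacent prism
  terms cancel and only the two ends remain.\<close>

lemma prism_homotopy:
  "cobd (prism g h u) xs + prism g h (cobd u) xs = u (map h xs) + u (map g xs)"
proof (induction xs arbitrary: u)
  case (Cons x xs)
  let ?v = "\<lambda>ys. u (g x # ys)"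
  \<comment> \<open>The bit identity behind the induction step. Its premise is the induction
    hypothesis for \<open>?v\<close>; \<open>p\<close> and \<open>b\<close> occur twice and drop
    out.\<close>
  have cancel: "p + (b + d) + (w + (y + b) + (p + q)) = w + z" if "d + q = y + z"
    for b d p q w y z :: bit
  proof -
    have "d = q + (y + z)"
      using that by (metis add.commute bit_double_left)
    then show ?thesis
      by (simp add: ac_simps)
  qed
  have "cobd (prism g h u) (x # xs) = prism g h u xs +
      (cobd (\<lambda>ys. u (g x # h x # map h ys)) xs + cobd (prism g h ?v) xs)"
    by (simp only: cobd.simps prism.simps cobd_add)
  moreover have "prism g h (cobd u) (x # xs) =
      u (map h (x # xs)) + (?v (map h xs) + cobd (\<lambda>ys. u (g x # h x # map h ys)) xs) +
      (prism g h u xs + prism g h (cobd ?v) xs)"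
    by (simp only: cobd.simps prism.simps prism_add cobd_map list.map)
  ultimately show ?case
    using cancel[OF Cons.IH[of ?v]] by (simp only: list.map)
qed simp

text \<open>Passing through intermediate maps \<open>H j\<close> keeps each prism thin. This matters
  because cochains will be controlled only on lists of small diameter.\<close>

definition prism_sum :: "(nat \<Rightarrow> 'a \<Rightarrow> 'a) \<Rightarrow> nat \<Rightarrow> ('a list \<Rightarrow> bit) \<Rightarrow> 'a list \<Rightarrow> bit" where
  "prism_sum H M u = (\<lambda>xs. \<Sum>j<M. prism (H j) (H (Suc j)) u xs)"

text \<open>The sum telescopes: the end of one prism is the start of the next, and modulo 2 these
  terms cancel.\<close>

lemma prism_sum_homotopy:
  "cobd (prism_sum H M u) xs + prism_sum H M (cobd u) xs = u (map (H M) xs) + u (map (H 0) xs)"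
proof (induction M)
  case (Suc M)
  have step: "prism_sum H (Suc M) v = (\<lambda>ys. prism_sum H M v ys + prism (H M) (H (Suc M)) v ys)"
    for v :: "'a list \<Rightarrow> bit"
    by (simp add: prism_sum_def)
  have cancel: "(p + b) + (q + d) = w + z" if "p + q = y + z" "b + d = w + y"
    for b d p q w y z :: bit
  proof -
    have "(p + b) + (q + d) = (p + q) + (b + d)"
      by (simp only: ac_simps)
    then show ?thesis
      unfolding that by (simp only: ac_simps bit_double_left)
  qed
  show ?case
    unfolding step cobd_add by (rule cancel[OF Suc prism_homotopy[of "H M" "H (Suc M)" u xs]])
qed (simp add: prism_sum_def)

lemma prism_sum_nonzeroD:
  assumes "prism_sum H M u xs \<noteq> 0"
  shows "\<exists>j<M. \<exists>ys. set ys \<subseteq> H j ` set xs \<union> H (Suc j) ` set xs \<and> u ys \<noteq> 0"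
proof -
  obtain j where "j < M" "prism (H j) (H (Suc j)) u xs \<noteq> 0"
    using assms sum.neutral[of "{..<M}" "\<lambda>j. prism (H j) (H (Suc j)) u xs"]
    unfolding prism_sum_def by blast
  then show ?thesis
    using prism_nonzeroD by blast
qed

section \<open>Indicator cochains of finite vertex sets\<close>

text \<open>The value is 1 exactly on the lists that enumerate \<open>s\<close> without
  repetition.\<close>

fun simplex_cochain :: "'v set \<Rightarrow> 'v list \<Rightarrow> bit" where
  "simplex_cochain s [] = (if s = {} then 1 else 0)"
| "simplex_cochain s (w # ws) = (if w \<in> s then simplex_cochain (s - {w}) ws else 0)"

lemma simplex_cochain_nonzeroD: "simplex_cochain s ws \<noteq> 0 \<Longrightarrow> s = set ws"
proof (induction ws arbitrary: s)
  case (Cons w ws)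
  from Cons.prems have w: "w \<in> s" and "simplex_cochain (s - {w}) ws \<noteq> 0"
    by (simp_all split: if_splits)
  from Cons.IH[OF this(2)] w show ?case by auto
qed (auto split: if_splits)

text \<open>If deleting an entry of \<open>ws\<close> leaves an enumeration of \<open>s\<close>,
  then either \<open>ws\<close> enumerates some \<open>insert v s\<close>, and just one deletion
  works, or \<open>ws\<close> repeats one element of \<open>s\<close>, and two deletions work and
  cancel.\<close>

lemma cobd_simplex_cochain:
  assumes "finite W" "set ws \<subseteq> W" "s \<subseteq> W"
  shows "cobd (simplex_cochain s) ws = (\<Sum>v\<in>W - s. simplex_cochain (insert v s) ws)"
  using assms(2,3)
proof (induction ws arbitrary: s)
  case (Cons w ws)
  show ?case
  proof (cases "w \<in> s")
    case True
    have "cobd (simplex_cochain s) (w # ws) =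
        simplex_cochain s ws + cobd (simplex_cochain (s - {w})) ws"
      using True by simp
    also have "cobd (simplex_cochain (s - {w})) ws =
        (\<Sum>v\<in>W - (s - {w}). simplex_cochain (insert v (s - {w})) ws)"
      using Cons.prems by (intro Cons.IH) auto
    \<comment> \<open>The extra index \<open>w\<close> contributes
      \<open>simplex_cochain s ws\<close> once more, which cancels the term from deleting the
      leading \<open>w\<close>.\<close>
    also have "W - (s - {w}) = insert w (W - s)"
      using True Cons.prems by auto
    also have "(\<Sum>v\<in>insert w (W - s). simplex_cochain (insert v (s - {w})) ws) =
        simplex_cochain s ws + (\<Sum>v\<in>W - s. simplex_cochain (insert v (s - {w})) ws)"
      using True \<open>finite W\<close> by (subst sum.insert) (auto simp: insert_absorb)
    also have "(\<Sum>v\<in>W - s. simplex_cochain (insert v (s - {w})) ws) =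
        (\<Sum>v\<in>W - s. simplex_cochain (insert v s) (w # ws))"
      by (intro sum.cong refl) (use True in \<open>auto simp: insert_Diff_if\<close>)
    finally show ?thesis
      by (simp only: bit_double_left)
  next
    case False
    have "(\<Sum>v\<in>W - s. simplex_cochain (insert v s) (w # ws)) =
        (\<Sum>v\<in>{w}. simplex_cochain (insert v s) (w # ws))"
      using False Cons.prems \<open>finite W\<close> by (intro sum.mono_neutral_right) auto
    also have "\<dots> = simplex_cochain s ws"
      using False by simp
    also have "\<dots> = cobd (simplex_cochain s) (w # ws)"
      using False by simp
    finally show ?thesis ..
  qed
next
  case Nil
  then show ?case by simp
qed

text \<open>Each unordered pair of new vertices is counted twice. This is the vanishing of the
  squared coboundary for indicator cochains.\<close>

lemma sum_pairs_mod2: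
  fixes b :: "'v set \<Rightarrow> bit"
  assumes "finite W"
  shows "(\<Sum>v\<in>W - t. \<Sum>w\<in>W - insert v t. b (insert w (insert v t))) = 0"
proof -
  define A where "A = W - t"
  have "finite A"
    using assms by (simp add: A_def)
  then have "(\<Sum>v\<in>A. \<Sum>w\<in>A - {v}. b (insert w (insert v t))) = 0"
  proof (induction A rule: finite_induct)
    case (insert a A)
    have 1: "insert a A - {v} = insert a (A - {v})" if "v \<in> A" for v
      using that insert by auto
    have "(\<Sum>v\<in>A. \<Sum>w\<in>insert a A - {v}. b (insert w (insert v t))) =
       (\<Sum>v\<in>A. b (insert a (insert v t)) + (\<Sum>w\<in>A - {v}. b (insert w (insert v t))))"
      by (intro sum.cong refl, subst 1) (use insert in auto)
    also have "\<dots> = (\<Sum>v\<in>A. b (insert v (insert a t)))"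
      by (simp only: sum.distrib insert.IH insert_commute[of a]) simp
    finally have "(\<Sum>v\<in>A. \<Sum>w\<in>insert a A - {v}. b (insert w (insert v t))) =
       (\<Sum>v\<in>A. b (insert v (insert a t)))" .
    moreover have "insert a A - {a} = A"
      using insert by auto
    ultimately show ?case
      by (subst sum.insert[OF insert.hyps]) (simp only: bit_double)
  qed simp
  moreover have "W - insert v t = A - {v}" for v
    by (auto simp: A_def)
  ultimately show ?thesis
    by (simp add: A_def)
qed

section \<open>Vanishing of compactly supported cocycles\<close>

text \<open>Alexander--Spanier cochains matter only near the diagonal. Working at a fixed scale
  \<open>e\<close> inside a fixed compact ball replaces germs by explicit bounds.\<close>

definition small_list :: "'a::metric_space \<Rightarrow> real \<Rightarrow> real \<Rightarrow> 'a list \<Rightarrow> bool" where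
  "small_list p L e xs \<longleftrightarrow>
    set xs \<subseteq> cball p L \<and> (\<forall>x\<in>set xs. \<forall>y\<in>set xs. dist x y < e)"

definition pushes_off :: "(real \<Rightarrow> 'a::metric_space \<Rightarrow> 'a) \<Rightarrow> 'a \<Rightarrow> real \<Rightarrow> real \<Rightarrow> bool" where
  "pushes_off h z r R \<longleftrightarrow>
    continuous_on ({0..1} \<times> UNIV) (\<lambda>(t, y). h t y) \<and> (\<forall>y. h 0 y = y) \<and>
    (\<forall>t\<in>{0..1}. \<forall>y. dist (h t y) y \<le> R) \<and> (\<forall>y. h 1 y \<notin> cball z r)"

lemma small_list_mono:
  "small_list p L e xs \<Longrightarrow> L \<le> L' \<Longrightarrow> e \<le> e' \<Longrightarrow> small_list p L' e' xs"
  unfolding small_list_def by fastforce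

lemma small_list_subset:
  "small_list p L e xs \<Longrightarrow> set ys \<subseteq> set xs \<Longrightarrow> small_list p L e ys"
  unfolding small_list_def by blast

text \<open>Pulled back along \<open>h 1\<close>, the cocycle \<open>u\<close> vanishes, because its
  support needs a point near \<open>q v0\<close> and \<open>h 1\<close> avoids that ball. The prism
  sum along \<open>h\<close> is therefore a primitive. Points move by at most \<open>R\<close>, so
  supports grow by \<open>R\<close> and control is lost on the outer shell of width
  \<open>R\<close>.\<close>

lemma bounded_primitive:
  fixes u :: "'a::metric_space list \<Rightarrow> bit"
  assumes proper: "\<And>(x::'a) r. compact (cball x r)"
    and push: "pushes_off h (q v0) r R" and v0: "v0 \<in> s"
    and "0 < e"
    and cocycle: "\<And>xs. small_list p (L + R) e xs \<Longrightarrow> cobd u xs = 0"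
    and supp: "\<And>xs. small_list p (L + R) e xs \<Longrightarrow> u xs \<noteq> 0 \<Longrightarrow>
      \<forall>v\<in>s. \<exists>x\<in>set xs. dist x (q v) \<le> r"
  shows "\<exists>b e'. 0 < e' \<and> (\<forall>xs. small_list p L e' xs \<longrightarrow> cobd b xs = u xs \<and>
      (b xs \<noteq> 0 \<longrightarrow> (\<forall>v\<in>s. \<exists>x\<in>set xs. dist x (q v) \<le> r + R)))"
proof -
  have cont: "continuous_on ({0..1} \<times> UNIV) (\<lambda>(t, y). h t y)"
    and h0: "\<And>y. h 0 y = y" and disp: "\<And>t y. t \<in> {0..1} \<Longrightarrow> dist (h t y) y \<le> R"
    and h1: "\<And>y. h 1 y \<notin> cball (q v0) r"
    using push unfolding pushes_off_def by blast+
  \<comment> \<open>Uniform continuity on a compact product yields \<open>d\<close>. Half of it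
    bounds the time step \<open>1 / M\<close>, the other half the diameter of lists, so that the
    vertices of each prism are \<open>e\<close>-close.\<close>
  have "uniformly_continuous_on ({0..1} \<times> cball p L) (\<lambda>(t, y). h t y)"
    by (intro compact_uniformly_continuous compact_Times proper compact_Icc
        continuous_on_subset[OF cont]) auto
  then obtain d where "0 < d" and d: "\<And>t y t' y'. t \<in> {0..1} \<Longrightarrow> y \<in> cball p L \<Longrightarrow> t' \<in> {0..1} \<Longrightarrow>
      y' \<in> cball p L \<Longrightarrow> dist (t, y) (t', y') < d \<Longrightarrow> dist (h t y) (h t' y') < e"
    unfolding uniformly_continuous_on_def using \<open>0 < e\<close> by fastforce
  obtain n where n: "1 / real (Suc n) < d / 2"
    using nat_approx_posE[of "d / 2"] \<open>0 < d\<close> by auto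
  define M where "M = Suc n"
  define H where "H j = h (real j / real M)" for j
  define b where "b = prism_sum H M u"
  have I: "real j / real M \<in> {0..1}" if "j \<le> M" for j
    using that by (auto simp: M_def field_simps)
  have move: "dist (H j x) x \<le> R" if "j \<le> M" for j x
    unfolding H_def by (intro disp I that)
  have near: "dist (H i x) (H j y) < e"
    if "x \<in> cball p L" "y \<in> cball p L" "dist x y < d / 2" "i \<le> M" "j \<le> M" "i \<le> Suc j" "j \<le> Suc i"
    for i j x y
  proof -
    have "\<bar>real i - real j\<bar> \<le> 1"
      using that by linarith
    then have "\<bar>real i / real M - real j / real M\<bar> \<le> 1 / real M"
      by (simp add: divide_right_mono abs_divide flip: diff_divide_distrib)
    then have "dist (real i / real M) (real j / real M) < d / 2"
      using n by (simp add: dist_real_def M_def)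
    then have "dist (real i / real M, x) (real j / real M, y) < d"
      unfolding dist_Pair_Pair using that(3)
      by (intro order.strict_trans1[OF sqrt_sum_squares_le_sum]) auto
    then show ?thesis
      unfolding H_def using that I by (intro d) auto
  qed
  have small: "small_list p (L + R) e ys"
    if xs: "small_list p L (d / 2) xs" and j: "j < M" and ys: "set ys \<subseteq> H j ` set xs \<union> H (Suc j) ` set xs"
    for xs ys j
  proof -
    have "\<exists>i x. x \<in> set xs \<and> y = H i x \<and> (i = j \<or> i = Suc j)" if "y \<in> set ys" for y
      using that ys by blast
    moreover have "H i x \<in> cball p (L + R)" if "x \<in> set xs" "i = j \<or> i = Suc j" for i x
      using that xs j move[of i x] dist_triangle[of p "H i x" x]
      by (force simp: small_list_def dist_commute)
    moreover have "dist (H i x) (H k y) < e"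
      if "x \<in> set xs" "y \<in> set xs" "i = j \<or> i = Suc j" "k = j \<or> k = Suc j" for i k x y
      using that xs j by (intro near) (auto simp: small_list_def)
    ultimately show ?thesis
      unfolding small_list_def by (metis subsetI)
  qed
  have "cobd b xs = u xs" if xs: "small_list p L (d / 2) xs" for xs
  proof -
    have "prism_sum H M (cobd u) xs = 0"
      using prism_sum_nonzeroD[of H M "cobd u" xs] small[OF xs] cocycle by blast
    moreover have "u (map (H M) xs) = 0"
    proof (rule ccontr)
      assume "u (map (H M) xs) \<noteq> 0"
      moreover have "small_list p (L + R) e (map (H M) xs)"
        \<comment> \<open>The end map \<open>H M\<close> belongs to the last prism, which has index
          \<open>n\<close> because \<open>M = Suc n\<close>.\<close>
        by (rule small[OF xs, of n]) (auto simp: M_def)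
      ultimately obtain x where "x \<in> set (map (H M) xs)" "dist x (q v0) \<le> r"
        using supp v0 by blast
      then show False
        using h1 by (auto simp: H_def M_def dist_commute)
    qed
    moreover have "map (H 0) xs = xs"
      by (simp add: H_def h0 map_idI)
    ultimately show ?thesis
      using prism_sum_homotopy[of H M u xs] by (simp add: b_def)
  qed
  moreover have "\<forall>v\<in>s. \<exists>x\<in>set xs. dist x (q v) \<le> r + R"
    if xs: "small_list p L (d / 2) xs" and "b xs \<noteq> 0" for xs
  proof
    fix v
    assume "v \<in> s"
    obtain j ys where j: "j < M" and ys: "set ys \<subseteq> H j ` set xs \<union> H (Suc j) ` set xs" and "u ys \<noteq> 0"
      using prism_sum_nonzeroD \<open>b xs \<noteq> 0\<close> unfolding b_def by blast
    then obtain y where "y \<in> set ys" "dist y (q v) \<le> r"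
      using supp small[OF xs j ys] \<open>v \<in> s\<close> by blast
    moreover obtain i x where "x \<in> set xs" "y = H i x" "i \<le> M"
    proof -
      have "y \<in> H j ` set xs \<union> H (Suc j) ` set xs"
        using \<open>y \<in> set ys\<close> ys by blast
      then show ?thesis
        using that j by (metis UnE imageE Suc_leI less_imp_le)
    qed
    ultimately show "\<exists>x\<in>set xs. dist x (q v) \<le> r + R"
      using move[of i x] dist_triangle[of x "q v" y] by (force simp: dist_commute)
  qed
  ultimately show ?thesis
    using \<open>0 < d\<close> by (intro exI[of _ b] exI[of _ "d / 2"]) auto
qed

section \<open>Descent on the cardinality of vertex sets\<close>

text \<open>Extended linearly, \<open>c\<close> is a cochain map on small lists, from the augmented
  simplicial cochains of the full simplex on \<open>W\<close>: the coboundary of the indicator of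
  \<open>s\<close> is the sum of those of \<open>insert v s\<close>. The point \<open>q v\<close>
  marks the location of the vertex \<open>v\<close>.\<close>

definition cochain_family ::
    "'a::metric_space \<Rightarrow> real \<Rightarrow> nat \<Rightarrow> real \<Rightarrow> 'v set \<Rightarrow> ('v \<Rightarrow> 'a) \<Rightarrow> ('v set \<Rightarrow> 'a list \<Rightarrow> bit) \<Rightarrow> real \<Rightarrow> bool"
  where
  "cochain_family p L m r W q c e \<longleftrightarrow> finite W \<and> 0 < e \<and> c {} [] = 1 \<and>
    (\<forall>s xs. s \<subseteq> W \<longrightarrow> small_list p L e xs \<longrightarrow>
      (m \<le> card s \<longrightarrow> c s xs = 0) \<and>
      cobd (c s) xs = (\<Sum>v\<in>W - s. c (insert v s) xs) \<and>
      (c s xs \<noteq> 0 \<longrightarrow> (\<forall>v\<in>s. \<exists>x\<in>set xs. dist x (q v) \<le> r)))"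

text \<open>For \<open>card s = m\<close> the relations make \<open>c s\<close> a cocycle, since the
  cochains of larger sets vanish. As \<open>1 \<le> m\<close>, such an \<open>s\<close> has a vertex
  to push away from, which gives a primitive \<open>b s\<close>. Changing \<open>c\<close> by the
  cochain homotopy \<open>b\<close> then kills level \<open>m\<close>.\<close>

lemma cochain_family_step:
  fixes p :: "'a::metric_space" and q :: "'v \<Rightarrow> 'a"
  assumes proper: "\<And>(x::'a) r. compact (cball x r)"
    and push: "\<And>z::'a. \<exists>h. pushes_off h z r R"
    and fam: "cochain_family p (L + R) (Suc m) r W q c e"
    and "1 \<le> m"
  shows "\<exists>c' e'. cochain_family p L m (r + R) W q c' e'"
proof -
  have "finite W" "0 < e" and c0: "c {} [] = 1"
    and top: "\<And>s xs. s \<subseteq> W \<Longrightarrow> small_list p (L + R) e xs \<Longrightarrow> Suc m \<le> card s \<Longrightarrow> c s xs = 0"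
    and cobd_c: "\<And>s xs. s \<subseteq> W \<Longrightarrow> small_list p (L + R) e xs \<Longrightarrow>
      cobd (c s) xs = (\<Sum>v\<in>W - s. c (insert v s) xs)"
    and supp: "\<And>s xs. s \<subseteq> W \<Longrightarrow> small_list p (L + R) e xs \<Longrightarrow> c s xs \<noteq> 0 \<Longrightarrow>
      \<forall>v\<in>s. \<exists>x\<in>set xs. dist x (q v) \<le> r"
    using fam unfolding cochain_family_def by blast+
  obtain h where "pushes_off h p r R"
    using push by blast
  then have "0 \<le> R"
    unfolding pushes_off_def
    by (metis atLeastAtMost_iff dist_self order_refl zero_le_one)
  define S where "S = {s. s \<subseteq> W \<and> card s = m}"
  have "finite S"
    unfolding S_def using \<open>finite W\<close> by simp
  have card_insert: "card (insert v s) = Suc (card s)" if "s \<subseteq> W" "v \<in> W - s" for v s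
    using that finite_subset[OF that(1) \<open>finite W\<close>] by simp
  have "\<exists>b e'. 0 < e' \<and> (\<forall>xs. small_list p L e' xs \<longrightarrow> cobd b xs = c s xs \<and>
      (b xs \<noteq> 0 \<longrightarrow> (\<forall>v\<in>s. \<exists>x\<in>set xs. dist x (q v) \<le> r + R)))" if "s \<in> S" for s
  proof -
    have s: "s \<subseteq> W" "card s = m"
      using that by (auto simp: S_def)
    then obtain v0 where "v0 \<in> s"
      using \<open>1 \<le> m\<close> by fastforce
    obtain h where h: "pushes_off h (q v0) r R"
      using push by blast
    have "cobd (c s) xs = 0" if "small_list p (L + R) e xs" for xs
    proof -
      have "c (insert v s) xs = 0" if "v \<in> W - s" for v
        using that s card_insert[OF s(1) that] \<open>small_list p (L + R) e xs\<close> by (intro top) auto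
      then show ?thesis
        using cobd_c[OF s(1) that] by simp
    qed
    then show ?thesis
      using bounded_primitive[where h = h and q = q and u = "c s" and s = s, OF proper h \<open>v0 \<in> s\<close> \<open>0 < e\<close>] supp[OF s(1)]
      by blast
  qed
  then obtain b0 e0 where "\<And>s. s \<in> S \<Longrightarrow> 0 < e0 s"
    and b0: "\<And>s xs. s \<in> S \<Longrightarrow> small_list p L (e0 s) xs \<Longrightarrow> cobd (b0 s) xs = c s xs"
      "\<And>s xs. s \<in> S \<Longrightarrow> small_list p L (e0 s) xs \<Longrightarrow> b0 s xs \<noteq> 0 \<Longrightarrow>
        \<forall>v\<in>s. \<exists>x\<in>set xs. dist x (q v) \<le> r + R"
    by metis
  \<comment> \<open>There are finitely many sets in \<open>S\<close>, so one scale serves all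
    primitives and the original family.\<close>
  define e' where "e' = Min (insert e (e0 ` S))"
  have "0 < e'"
    using \<open>finite S\<close> \<open>0 < e\<close> \<open>\<And>s. s \<in> S \<Longrightarrow> 0 < e0 s\<close> by (auto simp: e'_def)
  have small: "small_list p (L + R) e xs" if "small_list p L e' xs" for xs
    using that \<open>0 \<le> R\<close> \<open>finite S\<close> by (elim small_list_mono) (auto simp: e'_def)
  have small0: "small_list p L (e0 s) xs" if "s \<in> S" "small_list p L e' xs" for s xs
    using that(2) by (rule small_list_mono) (use that(1) \<open>finite S\<close> in \<open>auto simp: e'_def\<close>)
  define b where "b s = (if s \<in> S then b0 s else (\<lambda>xs. 0))" for s
  have b_supp: "\<forall>v\<in>s. \<exists>x\<in>set xs. dist x (q v) \<le> r + R"
    if "small_list p L e' xs" "b s xs \<noteq> 0" for s xs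
    using that b0(2) small0 by (auto simp: b_def split: if_splits)
  \<comment> \<open>The two added sums are \<open>b\<close> after the simplicial coboundary and the
    coboundary after \<open>b\<close>, so the relations survive.\<close>
  define c' where "c' t xs = c t xs + (\<Sum>v\<in>W - t. b (insert v t) xs) + cobd (b t) xs" for t xs
  have "c' {} [] = 1"
  proof -
    have "small_list p L e' []"
      by (simp add: small_list_def)
    \<comment> \<open>A nonzero value would need an entry of the empty list near
      \<open>q v\<close>.\<close>
    then have "b {v} [] = 0" for v
      using b_supp[of "[]" "{v}"] by auto
    then show ?thesis
      by (simp add: c'_def c0)
  qed
  moreover have "c' s xs = 0" if s: "s \<subseteq> W" and xs: "small_list p L e' xs" and "m \<le> card s" for s xs
  proof -
    have "b (insert v s) = (\<lambda>xs. 0)" if "v \<in> W - s" for v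
      using card_insert[OF s that] \<open>m \<le> card s\<close> by (auto simp: b_def S_def)
    then have "c' s xs = c s xs + cobd (b s) xs"
      by (simp add: c'_def)
    also have "\<dots> = 0"
    proof (cases "card s = m")
      case True
      then have "s \<in> S"
        using s by (simp add: S_def)
      then show ?thesis
        using b0(1) small0 xs by (simp add: b_def)
    next
      case False
      then have "s \<notin> S" "Suc m \<le> card s"
        using \<open>m \<le> card s\<close> by (auto simp: S_def)
      then show ?thesis
        using top[OF s small[OF xs]] by (simp add: b_def)
    qed
    finally show ?thesis .
  qed
  moreover have "cobd (c' s) xs = (\<Sum>v\<in>W - s. c' (insert v s) xs)"
    if s: "s \<subseteq> W" and xs: "small_list p L e' xs" for s xs
  proof -
    have "cobd (c' s) xs = (\<Sum>v\<in>W - s. c (insert v s) xs) + (\<Sum>v\<in>W - s. cobd (b (insert v s)) xs)"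
      unfolding c'_def cobd_add cobd_sum cobd_cobd cobd_c[OF s small[OF xs]] by simp
    moreover have "(\<Sum>v\<in>W - s. c' (insert v s) xs) =
        (\<Sum>v\<in>W - s. c (insert v s) xs) + (\<Sum>v\<in>W - s. cobd (b (insert v s)) xs)"
      unfolding c'_def sum.distrib sum_pairs_mod2[OF \<open>finite W\<close>, of "\<lambda>s. b s xs"] by simp
    ultimately show ?thesis by simp
  qed
  moreover have "\<forall>v\<in>s. \<exists>x\<in>set xs. dist x (q v) \<le> r + R"
    if s: "s \<subseteq> W" and xs: "small_list p L e' xs" and "c' s xs \<noteq> 0" for s xs
  proof -
    consider "c s xs \<noteq> 0" | "(\<Sum>v\<in>W - s. b (insert v s) xs) \<noteq> 0" | "cobd (b s) xs \<noteq> 0"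
      using \<open>c' s xs \<noteq> 0\<close> by (force simp: c'_def)
    then show ?thesis
    proof cases
      case 1
      then show ?thesis
        using supp[OF s small[OF xs]] \<open>0 \<le> R\<close> by force
    next
      case 2
      then obtain v where "b (insert v s) xs \<noteq> 0"
        using sum.neutral[of "W - s" "\<lambda>v. b (insert v s) xs"] by blast
      then show ?thesis
        using b_supp[OF xs] by blast
    next
      case 3
      then obtain ys where "set ys \<subseteq> set xs" "b s ys \<noteq> 0"
        using cobd_nonzeroD by blast
      then show ?thesis
        using b_supp[OF small_list_subset[OF xs]] by blast
    qed
  qed
  ultimately show ?thesis
    unfolding cochain_family_def using \<open>finite W\<close> \<open>0 < e'\<close>
    by (intro exI[of _ c'] exI[of _ e']) simp
qed

text \<open>The map \<open>f\<close> sends a point to a member of a fine cover, and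
  \<open>c s\<close> pulls back the indicator cochain of \<open>s\<close>. The order of the cover
  bounds the cardinality of the sets \<open>s\<close> that contribute.\<close>

lemma cochain_family_start:
  fixes p :: "'a::metric_space"
  assumes proper: "\<And>(x::'a) r. compact (cball x r)"
    and dim: "covering_dim_le (euclidean :: 'a topology) n"
  shows "\<exists>(W :: 'a set set) q c e. cochain_family p L (n + 2) 1 W q c e"
proof -
  define \<U> :: "'a set set" where "\<U> = range (\<lambda>x. ball x 1)"
  have U_open: "open U" if "U \<in> \<U>" for U
    using that by (auto simp: \<U>_def)
  have "x \<in> \<Union>\<U>" for x
    unfolding \<U>_def by (rule UN_I[of x]) simp_all
  then have U_cover: "\<Union>\<U> = UNIV"
    by blast
  have U: "(\<forall>U\<in>\<U>. openin euclidean U) \<and> \<Union>\<U> = topspace euclidean"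
    unfolding U_cover topspace_euclidean using U_open by (intro conjI ballI refl) (simp only: open_openin)
  note dim[unfolded covering_dim_le_def, THEN spec[of _ \<U>]]
  from mp[OF this U] obtain \<V> where V: "(\<forall>V\<in>\<V>. openin euclidean V) \<and> \<Union>\<V> = topspace euclidean \<and>
      (\<forall>V\<in>\<V>. \<exists>U\<in>\<U>. V \<subseteq> U) \<and>
      (\<forall>x\<in>topspace euclidean. finite {V\<in>\<V>. x \<in> V} \<and> card {V\<in>\<V>. x \<in> V} \<le> n + 1)"
    by (rule exE)
  have V_open: "\<And>V. V \<in> \<V> \<Longrightarrow> open V"
    using V[THEN conjunct1] by (simp only: open_openin)
  have V_cover: "\<Union>\<V> = (UNIV :: 'a set)"
    using V[THEN conjunct2, THEN conjunct1] by (simp only: topspace_euclidean)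
  have V_ref: "\<exists>x. V \<subseteq> ball x 1" if "V \<in> \<V>" for V
    using V[THEN conjunct2, THEN conjunct2, THEN conjunct1] that by (auto simp: \<U>_def)
  have V_ord: "finite {V\<in>\<V>. x \<in> V}" "card {V\<in>\<V>. x \<in> V} \<le> n + 1" for x
    using V[THEN conjunct2, THEN conjunct2, THEN conjunct2] unfolding topspace_euclidean
    by (metis UNIV_I)+
  obtain q where q: "\<And>V. V \<in> \<V> \<Longrightarrow> V \<subseteq> ball (q V) 1"
    using V_ref by metis
  obtain W where "W \<subseteq> \<V>" "finite W" and W: "cball p L \<subseteq> \<Union>W"
  proof (rule compactE[OF proper, of p L \<V>])
    show "cball p L \<subseteq> \<Union>\<V>"
      using V_cover by simp
  qed (use V_open in auto)
  \<comment> \<open>A Lebesgue number of the finite subcover.\<close>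
  obtain e where "0 < e" and e: "\<And>x. x \<in> cball p L \<Longrightarrow> \<exists>G\<in>W. ball x e \<subseteq> G"
  proof (rule Heine_Borel_lemma[OF proper W])
    show "open G" if "G \<in> W" for G
      using V_open \<open>W \<subseteq> \<V>\<close> that by blast
  qed blast
  obtain f where f: "\<And>x. x \<in> cball p L \<Longrightarrow> f x \<in> W \<and> ball x e \<subseteq> f x"
    using e by metis
  define c where "c s xs = simplex_cochain s (map f xs)" for s xs
  have "c {} [] = 1"
    by (simp add: c_def)
  moreover have "c s xs = 0" if "s \<subseteq> W" and xs: "small_list p L e xs" and "n + 2 \<le> card s" for s xs
  proof (rule ccontr)
    assume "c s xs \<noteq> 0"
    then have s: "s = f ` set xs"
      using simplex_cochain_nonzeroD[of s "map f xs"] by (simp add: c_def)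
    then obtain x where x: "x \<in> set xs"
      using \<open>n + 2 \<le> card s\<close> by fastforce
    \<comment> \<open>The entries are less than \<open>e\<close> apart and \<open>f y\<close>
      contains \<open>ball y e\<close>, so all members in \<open>s\<close> share the point
      \<open>x\<close>.\<close>
    have "x \<in> f y" if "y \<in> set xs" for y
      using f[of y] that x xs unfolding small_list_def by (auto simp: subset_iff)
    then have "s \<subseteq> {V\<in>\<V>. x \<in> V}"
      using s \<open>s \<subseteq> W\<close> \<open>W \<subseteq> \<V>\<close> by blast
    then have "card s \<le> n + 1"
      using V_ord[of x] card_mono order_trans by blast
    then show False
      using \<open>n + 2 \<le> card s\<close> by simp
  qed
  moreover have "cobd (c s) xs = (\<Sum>v\<in>W - s. c (insert v s) xs)"
    if "s \<subseteq> W" "small_list p L e xs" for s xs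
  proof -
    have "set (map f xs) \<subseteq> W"
      using that(2) f by (auto simp: small_list_def)
    then show ?thesis
      unfolding c_def cobd_map[symmetric] using \<open>finite W\<close> that(1)
      by (intro cobd_simplex_cochain)
  qed
  moreover have "\<forall>v\<in>s. \<exists>x\<in>set xs. dist x (q v) \<le> 1"
    if xs: "small_list p L e xs" and "c s xs \<noteq> 0" for s xs
  proof
    fix v
    assume "v \<in> s"
    moreover have "s = f ` set xs"
      using simplex_cochain_nonzeroD[of s "map f xs"] \<open>c s xs \<noteq> 0\<close> by (simp add: c_def)
    ultimately obtain x where x: "x \<in> set xs" "v = f x"
      by blast
    then have "x \<in> cball p L"
      using xs by (auto simp: small_list_def)
    then have "x \<in> v" "v \<in> \<V>"
      using f[of x] \<open>0 < e\<close> \<open>W \<subseteq> \<V>\<close> unfolding x(2) by auto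
    then show "\<exists>x\<in>set xs. dist x (q v) \<le> 1"
      using q[OF \<open>v \<in> \<V>\<close>] x(1) by (intro bexI[of _ x]) (auto simp: dist_commute less_imp_le subset_iff)
  qed
  ultimately have "cochain_family p L (n + 2) 1 W q c e"
    unfolding cochain_family_def using \<open>finite W\<close> \<open>0 < e\<close> by blast
  then show ?thesis by blast
qed

text \<open>After \<open>n + 1\<close> descents every \<open>c {v}\<close> vanishes on small lists.
  The relation for the empty set, evaluated at \<open>[p]\<close>, then reads
  \<open>c {} [] = 0\<close>.\<close>

theorem finite_dim_not_pushable:
  fixes p :: "'a::metric_space"
  assumes proper: "\<And>(x::'a) r. compact (cball x r)"
    and dim: "covering_dim_le (euclidean :: 'a topology) n"
    and push: "\<And>r. \<exists>R. \<forall>z::'a. \<exists>h. pushes_off h z r R"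
  shows False
proof -
  \<comment> \<open>The radius \<open>r\<close> must not depend on \<open>L\<close>: a step turns
    control on radius \<open>L + R\<close> into control on \<open>L\<close>, where \<open>R\<close>
    depends on \<open>r\<close>.\<close>
  have "\<exists>r. \<forall>L. \<exists>(W :: 'a set set) q c e. cochain_family p L (n + 2 - k) r W q c e"
    if "k \<le> n + 1" for k
    using that
  proof (induction k)
    case 0
    show ?case
      using cochain_family_start[OF proper dim, of p] by (intro exI[of _ 1]) simp
  next
    case (Suc k)
    then obtain r where r: "\<And>L. \<exists>(W :: 'a set set) q c e. cochain_family p L (n + 2 - k) r W q c e"
      by auto
    obtain R where R: "\<And>z::'a. \<exists>h. pushes_off h z r R"
      using push by blast
    have "\<exists>(W :: 'a set set) q c e. cochain_family p L (n + 2 - Suc k) (r + R) W q c e" for L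
    proof -
      obtain W :: "'a set set" and q c e where "cochain_family p (L + R) (n + 2 - k) r W q c e"
        using r by blast
      moreover have "n + 2 - k = Suc (n + 2 - Suc k)" "1 \<le> n + 2 - Suc k"
        using Suc.prems by auto
      ultimately show ?thesis
        using cochain_family_step[OF proper R] by metis
    qed
    then show ?case by blast
  qed
  from this[of "n + 1"] obtain r where "\<forall>L. \<exists>(W :: 'a set set) q c e. cochain_family p L 1 r W q c e"
    by auto
  then obtain W :: "'a set set" and q c e where fam: "cochain_family p 0 1 r W q c e"
    by blast
  have top: "\<And>s xs. s \<subseteq> W \<Longrightarrow> small_list p 0 e xs \<Longrightarrow> 1 \<le> card s \<Longrightarrow> c s xs = 0"
    and cobd_c: "\<And>s xs. s \<subseteq> W \<Longrightarrow> small_list p 0 e xs \<Longrightarrow>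
      cobd (c s) xs = (\<Sum>v\<in>W - s. c (insert v s) xs)"
    and "0 < e" "c {} [] = 1"
    using fam unfolding cochain_family_def by blast+
  have xs: "small_list p 0 e [p]"
    using \<open>0 < e\<close> by (simp add: small_list_def)
  have "c {v} [p] = 0" if "v \<in> W" for v
    by (rule top[OF _ xs]) (use that in auto)
  then have "cobd (c {}) [p] = 0"
    using cobd_c[OF _ xs, of "{}"] by simp
  then show False
    using \<open>c {} [] = 1\<close> by simp
qed

section \<open>Rays as limits of segments\<close>

lemma bicombing_endpoints:
  assumes "geodesic_bicombing \<sigma>"
  shows "\<sigma> x y 0 = x" "\<sigma> x y 1 = y"
  using assms by (auto simp: geodesic_bicombing_def const_speed_geodesic_def)

lemma bicombing_dist:
  assumes "geodesic_bicombing \<sigma>" "s \<in> {0..1}" "t \<in> {0..1}"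
  shows "dist (\<sigma> x y s) (\<sigma> x y t) = \<bar>s - t\<bar> * dist x y"
  using assms unfolding geodesic_bicombing_def const_speed_geodesic_def by blast

lemma bicombing_dist_start:
  assumes "geodesic_bicombing \<sigma>" "t \<in> {0..1}"
  shows "dist x (\<sigma> x y t) = t * dist x y"
  using bicombing_dist[OF assms(1), of 0 t x y] assms by (simp add: bicombing_endpoints)

lemma bicombing_tendsto:
  assumes "geodesic_bicombing \<sigma>"
    and "(a \<longlongrightarrow> x) F" "(b \<longlongrightarrow> y) F" "(u \<longlongrightarrow> t) F"
    and "t \<in> {0..1}" "\<forall>\<^sub>F n in F. u n \<in> {0..1}"
  shows "((\<lambda>n. \<sigma> (a n) (b n) (u n)) \<longlongrightarrow> \<sigma> x y t) F"
proof -
  have "continuous_on (UNIV \<times> UNIV \<times> {0..1}) (\<lambda>(x, y, t). \<sigma> x y t)"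
    using assms(1) by (simp add: geodesic_bicombing_def)
  moreover have "((\<lambda>n. (a n, b n, u n)) \<longlongrightarrow> (x, y, t)) F"
    by (intro tendsto_Pair assms)
  ultimately show ?thesis
    using continuous_on_tendsto_compose[where g = "\<lambda>n. (a n, b n, u n)" and l = "(x, y, t)"
        and f = "\<lambda>(x, y, t). \<sigma> x y t" and s = "UNIV \<times> UNIV \<times> {0..1}" and F = F] assms(5,6)
    by simp
qed

text \<open>Consistency compares only images; the distance from \<open>p\<close> then identifies the
  parameter. This fails for constant segments, which are treated apart.\<close>

lemma bicombing_initial_segment:
  assumes \<sigma>: "geodesic_bicombing \<sigma>" and "consistent_bicombing \<sigma>"
    and s: "s \<in> {0..1}" and t: "t \<in> {0..1}"
  shows "\<sigma> p (\<sigma> p y t) s = \<sigma> p y (t * s)"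
proof (cases "t = 0 \<or> p = y")
  case True
  have const: "\<sigma> p p u = p" if "u \<in> {0..1}" for u
    using bicombing_dist_start[OF \<sigma> that, of p p] by simp
  have "t * s \<in> {0..1}"
    using s t by (auto intro: mult_le_one)
  then show ?thesis
    using True const s t bicombing_endpoints[OF \<sigma>] by auto
next
  case False
  then have "\<sigma> (\<sigma> p y 0) (\<sigma> p y t) ` {0..1} = \<sigma> p y ` {0..t}"
    using assms(2) t unfolding consistent_bicombing_def by auto
  then have "\<sigma> p (\<sigma> p y t) s \<in> \<sigma> p y ` {0..t}"
    using s bicombing_endpoints[OF \<sigma>] by auto
  then obtain t' where t': "t' \<in> {0..t}" "\<sigma> p (\<sigma> p y t) s = \<sigma> p y t'"
    by blast
  have "t' * dist p y = dist p (\<sigma> p y t')"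
    using bicombing_dist_start[OF \<sigma>, of t'] t' t by simp
  also have "\<dots> = s * (t * dist p y)"
    unfolding t'(2)[symmetric] using bicombing_dist_start[OF \<sigma>] s t by simp
  finally have "t' = t * s"
    using False by simp
  then show ?thesis
    using t' by simp
qed

text \<open>A diagonal subsequence converges at all integer times. Initial segments and continuity
  of \<open>\<sigma>\<close> extend this to all times and carry the ray property to the
  limit.\<close>

lemma sigma_ray_limit:
  fixes y :: "nat \<Rightarrow> 'a::metric_space"
  assumes proper: "\<And>(x::'a) r. compact (cball x r)"
    and \<sigma>: "geodesic_bicombing \<sigma>" and cons: "consistent_bicombing \<sigma>"
    and far: "\<And>n. real n \<le> dist p (y n)"
  shows "\<exists>f \<xi>. strict_mono f \<and> sigma_ray \<sigma> \<xi> \<and> \<xi> 0 = p \<and>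
    (\<forall>t\<ge>0. (\<lambda>n. \<sigma> p (y (f n)) (min 1 (t / dist p (y (f n))))) \<longlonglongrightarrow> \<xi> t)"
proof -
  \<comment> \<open>Unit speed parametrization from \<open>p\<close>, resting at \<open>y n\<close>
    once the segment is used up.\<close>
  define g where "g n t = \<sigma> p (y n) (min 1 (t / dist p (y n)))" for n t
  have I: "min 1 (t / dist p (y n)) \<in> {0..1}" if "0 \<le> t" for t n
    using that by auto
  have g_bound: "g n t \<in> cball p t" if "0 \<le> t" for n t
  proof -
    have "dist p (g n t) = min 1 (t / dist p (y n)) * dist p (y n)"
      unfolding g_def by (rule bicombing_dist_start[OF \<sigma> I[OF that]])
    also have "\<dots> \<le> t"
      using that by (cases "y n = p") (auto simp: min_def field_simps)
    finally show ?thesis by simp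
  qed
  have g_g: "\<sigma> p (g n t) s = g n (t * s)" if "s \<in> {0..1}" "0 \<le> t" "t \<le> n" for n t s
  proof (cases "t = 0")
    case True
    then show ?thesis
      using bicombing_initial_segment[OF \<sigma> cons that(1), of 0 p "y n"]
      by (simp add: g_def)
  next
    case False
    then have d: "0 < dist p (y n)" "t \<le> dist p (y n)"
      using that far[of n] by auto
    have "t * s \<le> t"
      using that by (simp add: mult_left_le)
    then show ?thesis
      using bicombing_initial_segment[OF \<sigma> cons that(1) I[OF that(2)], of p "y n" n] d
      by (simp add: g_def min_absorb2)
  qed
  interpret subseqs "\<lambda>k s. convergent (\<lambda>n. g (s n) (real k))"
  proof
    fix k :: nat and s :: "nat \<Rightarrow> nat"
    have "seq_compact (cball p (real k))"
      by (intro compact_imp_seq_compact proper)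
    then obtain l r where "strict_mono r" "((\<lambda>n. g (s n) (real k)) \<circ> r) \<longlonglongrightarrow> l"
      using seq_compactE[of "cball p (real k)" "\<lambda>n. g (s n) (real k)"] g_bound by (metis of_nat_0_le_iff)
    then show "\<exists>r. strict_mono r \<and> convergent (\<lambda>n. g ((s \<circ> r) n) (real k))"
      by (auto simp: convergent_def o_def)
  qed
  define f where "f = diagseq"
  have "strict_mono f"
    unfolding f_def by (rule subseq_diagseq)
  then have f_ge: "n \<le> f n" for n
    by (rule seq_suble)
  have conv_nat: "convergent (\<lambda>n. g (f n) (real k))" for k
  proof -
    \<comment> \<open>The diagonal sequence is known to be good for \<open>k\<close> only from index
      \<open>Suc k\<close> on; the shift is undone afterwards.\<close>
    have "convergent (\<lambda>n. g ((diagseq \<circ> (+) (Suc k)) n) (real k))"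
    proof (rule diagseq_holds)
      fix r s :: "nat \<Rightarrow> nat" and n
      assume "strict_mono r" "convergent (\<lambda>i. g (s i) (real n))"
      then show "convergent (\<lambda>i. g ((s \<circ> r) i) (real n))"
        using convergent_subseq_convergent[of "\<lambda>i. g (s i) (real n)" r] by (simp add: o_def)
    qed
    then have "convergent (\<lambda>n. g (f (n + Suc k)) (real k))"
      by (simp add: f_def o_def add.commute)
    then show ?thesis
      using convergent_ignore_initial_segment[of "\<lambda>n. g (f n) (real k)" "Suc k"] by simp
  qed
  have "convergent (\<lambda>n. g (f n) t)" if "0 \<le> t" for t
  proof -
    define k where "k = Suc (nat \<lceil>t\<rceil>)"
    have k: "0 < k" "t \<le> real k"
      unfolding k_def by linarith+
    obtain l where l: "(\<lambda>n. g (f n) (real k)) \<longlonglongrightarrow> l"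
      using conv_nat convergent_def by blast
    have tk: "t / real k \<in> {0..1}"
      using k that by auto
    have "(\<lambda>n. \<sigma> p (g (f n) (real k)) (t / real k)) \<longlonglongrightarrow> \<sigma> p l (t / real k)"
      by (intro bicombing_tendsto[OF \<sigma>] tendsto_const l tk always_eventually allI)
    moreover have "\<forall>\<^sub>F n in sequentially. \<sigma> p (g (f n) (real k)) (t / real k) = g (f n) t"
    proof (rule eventually_sequentiallyI[of k])
      fix n
      assume "k \<le> n"
      then have "real k \<le> real (f n)"
        using f_ge[of n] by simp
      then show "\<sigma> p (g (f n) (real k)) (t / real k) = g (f n) t"
        using g_g[OF tk, of "real k" "f n"] k by simp
    qed
    ultimately have "(\<lambda>n. g (f n) t) \<longlonglongrightarrow> \<sigma> p l (t / real k)"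
      by (rule Lim_transform_eventually)
    then show ?thesis
      by (rule convergentI)
  qed
  then have "\<exists>l. 0 \<le> t \<longrightarrow> (\<lambda>n. g (f n) t) \<longlonglongrightarrow> l" for t
    by (auto simp: convergent_def)
  then obtain \<xi> where \<xi>: "\<And>t. 0 \<le> t \<Longrightarrow> (\<lambda>n. g (f n) t) \<longlonglongrightarrow> \<xi> t"
    by metis
  have "\<xi> 0 = p"
  proof -
    have "g n 0 = p" for n
      by (simp add: g_def bicombing_endpoints[OF \<sigma>])
    then show ?thesis
      using \<xi>[of 0] by (simp add: LIMSEQ_const_iff)
  qed
  have "dist (\<xi> s) (\<xi> t) = \<bar>s - t\<bar>" if "0 \<le> s" "0 \<le> t" for s t
  proof -
    have "(\<lambda>n. dist (g (f n) s) (g (f n) t)) \<longlonglongrightarrow> dist (\<xi> s) (\<xi> t)"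
      by (intro tendsto_dist \<xi> that)
    moreover have "\<forall>\<^sub>F n in sequentially. dist (g (f n) s) (g (f n) t) = \<bar>s - t\<bar>"
    proof (rule eventually_sequentiallyI[of "Suc (nat \<lceil>max s t\<rceil>)"])
      fix n
      assume "Suc (nat \<lceil>max s t\<rceil>) \<le> n"
      then have d: "0 < dist p (y (f n))" "s \<le> dist p (y (f n))" "t \<le> dist p (y (f n))"
        using f_ge[of n] far[of "f n"] by linarith+
      have "dist (g (f n) s) (g (f n) t) =
          \<bar>s / dist p (y (f n)) - t / dist p (y (f n))\<bar> * dist p (y (f n))"
        using bicombing_dist[OF \<sigma> I[OF that(1), of "f n"] I[OF that(2), of "f n"]] d
        by (simp add: g_def min_absorb2)
      also have "\<dots> = \<bar>s - t\<bar>"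
        using d by (simp add: abs_divide flip: diff_divide_distrib)
      finally show "dist (g (f n) s) (g (f n) t) = \<bar>s - t\<bar>" .
    qed
    ultimately have "(\<lambda>n. \<bar>s - t\<bar>) \<longlonglongrightarrow> dist (\<xi> s) (\<xi> t)"
      by (rule Lim_transform_eventually)
    then show ?thesis
      by (simp add: LIMSEQ_const_iff)
  qed
  moreover have "\<sigma> (\<xi> 0) (\<xi> t) ` {0..1} = \<xi> ` {0..t}" if "0 \<le> t" for t
  proof -
    have "\<sigma> p (\<xi> t) s = \<xi> (t * s)" if s: "s \<in> {0..1}" for s
    proof (rule LIMSEQ_unique)
      show "(\<lambda>n. g (f n) (t * s)) \<longlonglongrightarrow> \<xi> (t * s)"
        using \<open>0 \<le> t\<close> s by (intro \<xi>) simp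
      have "(\<lambda>n. \<sigma> p (g (f n) t) s) \<longlonglongrightarrow> \<sigma> p (\<xi> t) s"
        by (intro bicombing_tendsto[OF \<sigma>] tendsto_const \<xi> \<open>0 \<le> t\<close> s always_eventually allI)
      moreover have "\<forall>\<^sub>F n in sequentially. \<sigma> p (g (f n) t) s = g (f n) (t * s)"
      proof (rule eventually_sequentiallyI[of "nat \<lceil>t\<rceil>"])
        fix n
        assume "nat \<lceil>t\<rceil> \<le> n"
        then have "t \<le> real (f n)"
          using f_ge[of n] by linarith
        then show "\<sigma> p (g (f n) t) s = g (f n) (t * s)"
          by (rule g_g[OF s \<open>0 \<le> t\<close>])
      qed
      ultimately show "(\<lambda>n. g (f n) (t * s)) \<longlonglongrightarrow> \<sigma> p (\<xi> t) s"
        by (rule Lim_transform_eventually)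
    qed
    then have "\<sigma> p (\<xi> t) ` {0..1} = \<xi> ` ((\<lambda>s. t * s) ` {0..1})"
      unfolding image_image by (intro image_cong) auto
    also have "(\<lambda>s. t * s) ` {0..1} = {0..t}"
      using \<open>0 \<le> t\<close> by (simp add: image_mult_atLeastAtMost_if)
    finally show ?thesis
      by (simp add: \<open>\<xi> 0 = p\<close>)
  qed
  ultimately have "sigma_ray \<sigma> \<xi>"
    by (simp add: sigma_ray_def)
  then show ?thesis
    using \<open>strict_mono f\<close> \<open>\<xi> 0 = p\<close> \<xi> unfolding g_def by blast
qed

text \<open>Otherwise ever longer segments from \<open>p\<close> meet the ball. The arc lengths
  \<open>s n\<close> at which they do are bounded, and at an accumulation point \<open>l\<close> of
  them the limit ray lies in the closed ball.\<close>

lemma long_segments_miss_ball: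
  fixes p x :: "'a::metric_space"
  assumes proper: "\<And>(x::'a) r. compact (cball x r)"
    and \<sigma>: "geodesic_bicombing \<sigma>" and cons: "consistent_bicombing \<sigma>"
    and no_ray: "\<And>\<xi>. sigma_ray \<sigma> \<xi> \<Longrightarrow> \<xi> 0 = p \<Longrightarrow> \<xi> ` {0..} \<inter> cball x C = {}"
  shows "\<exists>R>0. \<forall>y. R \<le> dist p y \<longrightarrow> (\<forall>t\<in>{0..1}. \<sigma> p y t \<notin> cball x C)"
proof (rule ccontr)
  assume neg: "\<not> ?thesis"
  have "\<exists>y t. real (Suc n) \<le> dist p y \<and> t \<in> {0..1} \<and> \<sigma> p y t \<in> cball x C" for n
    using neg by (metis of_nat_0_less_iff zero_less_Suc)
  then obtain y t where far: "\<And>n. real (Suc n) \<le> dist p (y n)" and t: "\<And>n. t n \<in> {0..1}"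
    and hit: "\<And>n. \<sigma> p (y n) (t n) \<in> cball x C"
    by metis
  have far': "real n \<le> dist p (y n)" for n
    using far[of n] by simp
  obtain f \<xi> where f: "strict_mono f" and ray: "sigma_ray \<sigma> \<xi>" "\<xi> 0 = p"
    and lim: "\<And>t. 0 \<le> t \<Longrightarrow> (\<lambda>n. \<sigma> p (y (f n)) (min 1 (t / dist p (y (f n))))) \<longlonglongrightarrow> \<xi> t"
    using sigma_ray_limit[OF proper \<sigma> cons far'] by blast
  define s where "s n = t n * dist p (y n)" for n
  have "s n \<in> {0..dist p x + C}" for n
    using bicombing_dist_start[OF \<sigma> t, of p "y n" n] hit[of n] t[of n]
      dist_triangle[of p "\<sigma> p (y n) (t n)" x]
    by (auto simp: s_def)
  then obtain l g where "l \<in> {0..dist p x + C}" "strict_mono g" and g: "((\<lambda>n. s (f n)) \<circ> g) \<longlonglongrightarrow> l"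
    using seq_compactE[OF compact_imp_seq_compact[OF compact_Icc], of "\<lambda>n. s (f n)"] by metis
  then have "0 \<le> l" by simp
  define h where "h n = f (g n)" for n
  have h_lim: "(\<lambda>n. \<sigma> p (y (h n)) (min 1 (l / dist p (y (h n))))) \<longlonglongrightarrow> \<xi> l"
    using LIMSEQ_subseq_LIMSEQ[OF lim[OF \<open>0 \<le> l\<close>] \<open>strict_mono g\<close>] by (simp add: o_def h_def)
  \<comment> \<open>Comparing the hit point with the point at the fixed length \<open>l\<close>
    makes pointwise convergence at \<open>l\<close> sufficient.\<close>
  have close: "dist x (\<sigma> p (y n) (min 1 (l / dist p (y n)))) \<le> C + \<bar>s n - l\<bar>" for n
  proof -
    let ?d = "dist p (y n)"
    have "0 < ?d"
      using far[of n] by linarith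
    have "t n = min 1 (s n / ?d)"
      using t[of n] \<open>0 < ?d\<close> by (simp add: s_def)
    then have "dist (\<sigma> p (y n) (t n)) (\<sigma> p (y n) (min 1 (l / ?d))) =
        \<bar>min 1 (s n / ?d) - min 1 (l / ?d)\<bar> * ?d"
      using bicombing_dist[OF \<sigma> t, of "min 1 (l / ?d)" p "y n" n] \<open>0 \<le> l\<close> by simp
    also have "\<dots> \<le> \<bar>s n / ?d - l / ?d\<bar> * ?d"
      by (intro mult_right_mono) auto
    also have "\<dots> = \<bar>s n - l\<bar>"
      using \<open>0 < ?d\<close> by (simp add: abs_divide flip: diff_divide_distrib)
    finally show ?thesis
      using hit[of n] dist_triangle[of x "\<sigma> p (y n) (min 1 (l / ?d))" "\<sigma> p (y n) (t n)"] by simp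
  qed
  have "(\<lambda>n. C + \<bar>s (h n) - l\<bar>) \<longlonglongrightarrow> C + \<bar>l - l\<bar>"
    using g by (intro tendsto_intros) (simp add: o_def h_def)
  then have "dist x (\<xi> l) \<le> C"
    using LIMSEQ_le[OF tendsto_dist[OF tendsto_const h_lim]] close by fastforce
  then show False
    using no_ray[OF ray] \<open>0 \<le> l\<close> by auto
qed

section \<open>Pushing towards a base point\<close>

text \<open>At time 1 a point at distance at least \<open>R\<close> is still on its segment, which
  misses the ball; any other point has reached \<open>p\<close>, which lies outside the
  ball.\<close>

lemma pushes_off_toward_point:
  fixes p x :: "'a::metric_space"
  assumes \<sigma>: "geodesic_bicombing \<sigma>" and "0 < R" and p: "p \<notin> cball x C"
    and miss: "\<And>y t. R \<le> dist p y \<Longrightarrow> t \<in> {0..1} \<Longrightarrow> \<sigma> p y t \<notin> cball x C"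
  shows "pushes_off (\<lambda>t y. \<sigma> p y (1 - t * (R / max (dist p y) R))) x C R"
proof -
  define w where "w y = R / max (dist p y) R" for y
  have w: "w y \<in> {0..1}" for y
    using \<open>0 < R\<close> by (auto simp: w_def max_def divide_le_eq_1)
  have I: "1 - t * w y \<in> {0..1}" if "t \<in> {0..1}" for t y
    using that w[of y] by (auto intro: mult_le_one)
  have "continuous_on ({0..1} \<times> UNIV) (\<lambda>(t, y). \<sigma> p y (1 - t * w y))"
  proof -
    have c: "continuous_on (UNIV \<times> UNIV \<times> {0..1}) (\<lambda>(x, y, t). \<sigma> x y t)"
      using \<sigma> by (simp add: geodesic_bicombing_def)
    have "continuous_on ({0..1} \<times> UNIV) (\<lambda>z. (p, snd z, 1 - fst z * w (snd z)))"
      unfolding w_def using \<open>0 < R\<close> by (intro continuous_intros) (auto simp: max_def)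
    from continuous_on_compose2[OF c this] I show ?thesis
      by (fastforce simp: case_prod_beta)
  qed
  moreover have "dist (\<sigma> p y (1 - t * w y)) y \<le> R" if t: "t \<in> {0..1}" for t y
  proof -
    have "dist (\<sigma> p y (1 - t * w y)) y = t * w y * dist p y"
      using bicombing_dist[OF \<sigma> I[OF t, of y], of 1 p y] t w[of y] bicombing_endpoints(2)[OF \<sigma>, of p y] by simp
    also have "\<dots> \<le> w y * dist p y"
      using t w[of y] by (simp add: mult_left_le_one_le mult.assoc)
    also have "\<dots> \<le> R"
      using \<open>0 < R\<close> by (auto simp: w_def max_def field_simps)
    finally show ?thesis .
  qed
  moreover have "\<sigma> p y (1 - 1 * w y) \<notin> cball x C" for y
  proof (cases "R \<le> dist p y")
    case True
    then show ?thesis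
      using I[of 1 y] by (intro miss) auto
  next
    case False
    then have "w y = 1"
      using \<open>0 < R\<close> by (simp add: w_def max_def)
    then show ?thesis
      using p bicombing_endpoints[OF \<sigma>] by simp
  qed
  ultimately show ?thesis
    unfolding pushes_off_def by (simp add: w_def[symmetric] bicombing_endpoints[OF \<sigma>])
qed

text \<open>The isometry \<open>a\<close> carries \<open>cball x C\<close> onto a ball about
  \<open>a x\<close> that contains \<open>cball z r\<close>.\<close>

lemma pushes_off_conjugate:
  fixes a b :: "'a::metric_space \<Rightarrow> 'a"
  assumes push: "pushes_off h x C R"
    and a: "\<And>y z. dist (a y) (a z) = dist y z" and ab: "\<And>y. a (b y) = y"
    and C: "r + dist (a x) z \<le> C"
  shows "pushes_off (\<lambda>t y. a (h t (b y))) z r R"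
proof -
  have cont: "continuous_on ({0..1} \<times> UNIV) (\<lambda>(t, y). h t y)"
    and h0: "\<And>y. h 0 y = y" and disp: "\<And>t y. t \<in> {0..1} \<Longrightarrow> dist (h t y) y \<le> R"
    and h1: "\<And>y. h 1 y \<notin> cball x C"
    using push unfolding pushes_off_def by blast+
  have isometry_continuous: "continuous_on S c" if "\<And>y z. dist (c y) (c z) = dist y z" for c :: "'a \<Rightarrow> 'a" and S
    unfolding continuous_on_iff that by blast
  have b: "dist (b y) (b z) = dist y z" for y z
    using a[of "b y" "b z"] by (simp add: ab)
  have "continuous_on ({0..1} \<times> UNIV) (\<lambda>z. (fst z, b (snd z)))"
    by (intro continuous_intros continuous_on_compose2[OF isometry_continuous[OF b]]) auto
  then have "continuous_on ({0..1} \<times> UNIV) (\<lambda>z. h (fst z) (b (snd z)))"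
    using continuous_on_compose2[OF cont] by (fastforce simp: case_prod_beta)
  then have "continuous_on ({0..1} \<times> UNIV) (\<lambda>(t, y). a (h t (b y)))"
    unfolding case_prod_beta by (rule continuous_on_compose2[OF isometry_continuous[OF a] _ subset_UNIV])
  moreover have "dist (a (h t (b y))) y \<le> R" if "t \<in> {0..1}" for t y
    using disp[OF that, of "b y"] a[of "h t (b y)" "b y"] by (simp add: ab)
  moreover have "a (h 1 (b y)) \<notin> cball z r" for y
    using h1[of "b y"] C a[of x "h 1 (b y)"] dist_triangle[of "a x" "a (h 1 (b y))" z] by simp
  ultimately show ?thesis
    unfolding pushes_off_def by (simp add: h0 ab)
qed

text \<open>The sets of orbits meeting \<open>ball p n\<close> form an increasing open cover of the
  compact orbit space, so a single ball meets every orbit. Any two points can be moved into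
  it.\<close>

lemma cocompact_coarsely_transitive:
  fixes \<phi> :: "'g \<Rightarrow> 'a::metric_space \<Rightarrow> 'a"
  assumes act: "isometric_action G \<phi>" and cocomp: "cocompact_action G \<phi>"
  shows "\<exists>\<rho>. \<forall>x y. \<exists>g\<in>carrier G. dist (\<phi> g x) y \<le> \<rho>"
proof -
  have "group_action G UNIV \<phi>" and iso: "\<And>g x y. g \<in> carrier G \<Longrightarrow> dist (\<phi> g x) (\<phi> g y) = dist x y"
    using act unfolding isometric_action_def by auto
  interpret group_action G UNIV \<phi> by fact
  interpret group G
    using group_hom group_hom.axioms(1) by blast
  obtain p :: 'a where True by blast
  define N where "N n = {Q \<in> orbits G UNIV \<phi>. Q \<inter> ball p (real n) \<noteq> {}}" for n :: nat
  have N_mono: "N m \<subseteq> N n" if "m \<le> n" for m n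
    using that unfolding N_def by (fastforce simp: ball_def)
  have N_open: "openin (orbit_topology G euclidean \<phi>) (N n)" for n
  proof -
    have "{x \<in> topspace euclidean. orbit G \<phi> x \<in> N n} = (\<Union>g\<in>carrier G. \<phi> g -` ball p (real n))"
      by (auto simp: N_def orbits_def orbit_def)
    moreover have "open (\<phi> g -` ball p (real n))" if "g \<in> carrier G" for g
    proof (rule open_vimage[OF open_ball])
      show "continuous_on UNIV (\<phi> g)"
        unfolding continuous_on_iff iso[OF that] by blast
    qed
    ultimately have "openin euclidean {x \<in> topspace euclidean. orbit G \<phi> x \<in> N n}"
      by (simp add: open_UN)
    moreover have "N n \<subseteq> orbits G (topspace euclidean) \<phi>"
      by (auto simp: N_def)
    ultimately show ?thesis
      unfolding openin_orbit_topology by blast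
  qed
  have cover: "orbits G UNIV \<phi> \<subseteq> \<Union>(range N)"
  proof
    fix Q
    assume Q: "Q \<in> orbits G UNIV \<phi>"
    then obtain x where "x \<in> Q"
      using orbit_refl by (auto simp: orbits_def)
    moreover obtain n :: nat where "dist p x < real n"
      using reals_Archimedean2 by blast
    ultimately have "Q \<in> N n"
      using Q by (auto simp: N_def)
    then show "Q \<in> \<Union>(range N)"
      by blast
  qed
  obtain \<F> where \<F>: "finite \<F>" "\<F> \<subseteq> range N" "orbits G UNIV \<phi> \<subseteq> \<Union>\<F>"
  proof -
    have "compactin (orbit_topology G euclidean \<phi>) (orbits G UNIV \<phi>)"
      using cocomp by (simp add: cocompact_action_def compact_space_def topspace_orbit_topology)
    from compactinD[OF this _ cover] N_open show ?thesis
      using that by blast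
  qed
  then obtain A where "finite A" "\<F> = N ` A"
    by (meson finite_subset_image)
  \<comment> \<open>Inserting 0 covers the case of an empty \<open>A\<close>.\<close>
  define m where "m = Max (insert 0 A)"
  have "k \<le> m" if "k \<in> A" for k
    using that \<open>finite A\<close> by (simp add: m_def)
  then have "\<Union>\<F> \<subseteq> N m"
    using \<open>\<F> = N ` A\<close> N_mono by blast
  have near: "\<exists>g\<in>carrier G. dist p (\<phi> g x) < real m" for x
  proof -
    have "orbit G \<phi> x \<in> N m"
      using \<F>(3) \<open>\<Union>\<F> \<subseteq> N m\<close> by (auto simp: orbits_def)
    then show ?thesis
      by (auto simp: N_def orbit_def)
  qed
  have "\<exists>g\<in>carrier G. dist (\<phi> g x) y \<le> 2 * real m" for x y
  proof -
    obtain g k where g: "g \<in> carrier G" "dist p (\<phi> g x) < real m"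
      and k: "k \<in> carrier G" "dist p (\<phi> k y) < real m"
      using near by meson
    have "\<phi> (inv\<^bsub>G\<^esub> k \<otimes>\<^bsub>G\<^esub> g) x = \<phi> (inv\<^bsub>G\<^esub> k) (\<phi> g x)"
      using g k by (intro composition_rule) auto
    moreover have "\<phi> (inv\<^bsub>G\<^esub> k) (\<phi> k y) = y"
      using k composition_rule[of y "inv\<^bsub>G\<^esub> k" k] id_eq_one by (metis UNIV_I inv_closed l_inv restrict_apply')
    ultimately have "dist (\<phi> (inv\<^bsub>G\<^esub> k \<otimes>\<^bsub>G\<^esub> g) x) y = dist (\<phi> g x) (\<phi> k y)"
      using iso[of "inv\<^bsub>G\<^esub> k" "\<phi> g x" "\<phi> k y"] k by simp
    also have "\<dots> \<le> 2 * real m"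
      using g k dist_triangle3[of "\<phi> g x" "\<phi> k y" p] by simp
    finally show ?thesis
      using g k by blast
  qed
  then show ?thesis by blast
qed

theorem theorem10:
  fixes \<sigma> :: "'a::metric_space \<Rightarrow> 'a \<Rightarrow> real \<Rightarrow> 'a"
    and G :: "('g, 'm) monoid_scheme"
    and \<phi> :: "'g \<Rightarrow> 'a \<Rightarrow> 'a"
  assumes "proper_metric_space TYPE('a)"
    and "finite_covering_dim (euclidean :: 'a topology)"
    and "geodesic_space TYPE('a)"
    and "geodesic_bicombing \<sigma>"
    and "consistent_bicombing \<sigma>"
    and "conical_bicombing \<sigma>"
    and "isometric_action G \<phi>"
    and "cocompact_action G \<phi>"
    and "\<exists>a\<in>sigma_boundary \<sigma>. \<exists>b\<in>sigma_boundary \<sigma>. a \<noteq> b"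
  shows "almost_geodesically_complete \<sigma>"
proof (rule ccontr)
  assume incomplete: "\<not> almost_geodesically_complete \<sigma>"
  note \<sigma> = assms(4) and cons = assms(5)
  have proper: "compact (cball x r)" for x :: 'a and r
    using assms(1) unfolding proper_metric_space_def by blast
  obtain n where dim: "covering_dim_le (euclidean :: 'a topology) n"
    using assms(2) unfolding finite_covering_dim_def by blast
  \<comment> \<open>A boundary class supplies a ray, and its origin becomes the base point.\<close>
  obtain \<xi>0 where \<xi>0: "sigma_ray \<sigma> \<xi>0"
    using assms(9) unfolding sigma_boundary_def by (auto elim!: quotientE)
  define p where "p = \<xi>0 0"
  obtain \<rho> where \<rho>: "\<And>x y. \<exists>g\<in>carrier G. dist (\<phi> g x) y \<le> \<rho>"
    using cocompact_coarsely_transitive[OF assms(7,8)] by blast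
  have "group_action G UNIV \<phi>" and iso: "\<And>g x y. g \<in> carrier G \<Longrightarrow> dist (\<phi> g x) (\<phi> g y) = dist x y"
    using assms(7) unfolding isometric_action_def by auto
  interpret group_action G UNIV \<phi> by fact
  have "\<exists>R. \<forall>z::'a. \<exists>h. pushes_off h z r R" for r
  proof -
    \<comment> \<open>The constant must be positive to contradict completeness, and at least
      \<open>r + \<rho>\<close> so that a translate of the missed ball contains
      \<open>cball z r\<close>. Both \<open>x\<close> and \<open>R\<close> are chosen before
      \<open>z\<close>.\<close>
    define C where "C = max (r + \<rho>) 1"
    obtain x where no_ray: "\<And>\<xi>. sigma_ray \<sigma> \<xi> \<Longrightarrow> \<xi> 0 = p \<Longrightarrow> \<xi> ` {0..} \<inter> cball x C = {}"
      using incomplete unfolding almost_geodesically_complete_def C_def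
      by (metis less_max_iff_disj zero_less_one)
    \<comment> \<open>The ray \<open>\<xi>0\<close> starts at \<open>p\<close> and misses the
      ball.\<close>
    have "p \<notin> cball x C"
      using no_ray[OF \<xi>0] by (force simp: p_def)
    obtain R where "0 < R" and miss: "\<And>y t. R \<le> dist p y \<Longrightarrow> t \<in> {0..1} \<Longrightarrow> \<sigma> p y t \<notin> cball x C"
      using long_segments_miss_ball[OF proper \<sigma> cons no_ray] by blast
    obtain h where h: "pushes_off h x C R"
      using pushes_off_toward_point[OF \<sigma> \<open>0 < R\<close> \<open>p \<notin> cball x C\<close> miss] by blast
    have "\<exists>h. pushes_off h z r R" for z :: 'a
    proof -
      obtain g where g: "g \<in> carrier G" "dist (\<phi> g x) z \<le> \<rho>"
        using \<rho> by blast
      obtain b where b: "\<And>y. \<phi> g (b y) = y"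
        using surj_prop[OF g(1)] by (metis surjD)
      have "r + dist (\<phi> g x) z \<le> C"
        using g by (simp add: C_def)
      then show ?thesis
        using pushes_off_conjugate[OF h iso[OF g(1)] b] by blast
    qed
    then show ?thesis by blast
  qed
  then show False
    by (rule finite_dim_not_pushable[OF proper dim])
qed

end
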